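(* For any compact space $K$ the following conditions are equivalent: (i) $K$ is $NY$ compact; (ii) the Alexandroff duplicate $AD(K)$ is $NY$ compact; (iii) the Alexandroff duplicate $AD(K)$ is $NY$-Valdivia compact.
   Context: All spaces are assumed to be Tychonoff; in particular compact spaces are Hausdorff. The Alexandroff duplicate $AD(X)$ of a space $X$ is the set $X\times\{0,1\}$ with the following topology: points of $X\times\{1\}$ are isolated, and a basic open neighborhood of $(x,0)$ is of the form $(U\times\{0,1\})\setminus\{(x,1)\}$, where $U$ is an open neighborhood of $x$ in $X$. For a family $\{X_\gamma:\gamma\in\Gamma\}$ of spaces and a point $a=(a_\gamma)_{\gamma\in\Gamma}\in\prod_{\gamma\in\Gamma}X_\gamma$, let $\sigma(\prod_{\gamma\in\Gamma}X_\gamma,a)=\{x\in\prod_{\gamma\in\Gamma}X_\gamma:\{\gamma\in\Gamma:x_\gamma\neq a_\gamma\}\text{ is finite}\}$. If every $X_\gamma=Q_\gamma=[0,1]^\omega$ is the Hilbert cube, then $\sigma(\prod_{\gamma\in\Gamma}Q_\gamma)$ denotes this $\sigma$-product based at the point all of whose coordinates are $(0,0,\ldots)\in[0,1]^\omega$. A compact space $K$ is $NY$ compact if $K$ embeds homeomorphically into $\sigma(\prod_{\gamma\in\Gamma}X_\gamma,a)$ for some family $\{X_\gamma:\gamma\in\Gamma\}$ of compact metrizable spaces and some $a\in\prod_{\gamma\in\Gamma}X_\gamma$. A compact space $K$ is $NY$-Valdivia if, for some set $\Gamma$, there is a homeomorphic embedding $h:K\to\prod_{\gamma\in\Gamma}Q_\gamma$,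 where $Q_\gamma=[0,1]^\omega$ for all $\gamma$, such that $h(K)\cap\sigma(\prod_{\gamma\in\Gamma}Q_\gamma)$ is dense in $h(K)$. *)

theory Defs
  imports "HOL-Analysis.Analysis"
begin

definition alexandroff_duplicate :: "'a topology \<Rightarrow> ('a \<times> bool) topology" where
  "alexandroff_duplicate X = topology (\<lambda>W. W \<subseteq> topspace X \<times> UNIV \<and>
     (\<forall>x. (x, False) \<in> W \<longrightarrow>
        (\<exists>U. openin X U \<and> x \<in> U \<and> (U \<times> UNIV) - {(x, True)} \<subseteq> W)))"

lemma openin_alexandroff_duplicate:
  "openin (alexandroff_duplicate X) W \<longleftrightarrow> W \<subseteq> topspace X \<times> UNIV \<and>
     (\<forall>x. (x, False) \<in> W \<longrightarrow>
        (\<exists>U. openin X U \<and> x \<in> U \<and> (U \<times> UNIV) - {(x, True)} \<subseteq> W))"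
proof -
  let ?P = "\<lambda>W. W \<subseteq> topspace X \<times> UNIV \<and>
     (\<forall>x. (x, False) \<in> W \<longrightarrow>
        (\<exists>U. openin X U \<and> x \<in> U \<and> (U \<times> (UNIV::bool set)) - {(x, True)} \<subseteq> W))"
  have "istopology ?P"
    unfolding istopology_def
  proof (intro conjI allI impI)
    fix S T x
    assume S: "?P S" and T: "?P T"
    show "S \<inter> T \<subseteq> topspace X \<times> UNIV" using S by blast
    assume "(x, False) \<in> S \<inter> T"
    then obtain U V where "openin X U" "x \<in> U" "(U \<times> UNIV) - {(x, True)} \<subseteq> S"
      "openin X V" "x \<in> V" "(V \<times> UNIV) - {(x, True)} \<subseteq> T"
      using S T by (meson IntD1 IntD2)
    then show "\<exists>U. openin X U \<and> x \<in> U \<and> (U \<times> UNIV) - {(x, True)} \<subseteq> S \<inter> T"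
      by (intro exI[of _ "U \<inter> V"]) auto
  next
    fix \<K> :: "('a \<times> bool) set set" and x
    assume K: "\<forall>S\<in>\<K>. ?P S"
    then show "\<Union>\<K> \<subseteq> topspace X \<times> UNIV" by blast
    assume "(x, False) \<in> \<Union>\<K>"
    then obtain S where "S \<in> \<K>" "(x, False) \<in> S" by blast
    with K obtain U where "openin X U" "x \<in> U" "(U \<times> UNIV) - {(x, True)} \<subseteq> S"
      by meson
    then show "\<exists>U. openin X U \<and> x \<in> U \<and> (U \<times> UNIV) - {(x, True)} \<subseteq> \<Union>\<K>"
      using \<open>S \<in> \<K>\<close> by (intro exI[of _ U]) blast
  qed
  then show ?thesis
    unfolding alexandroff_duplicate_def by (simp add: topology_inverse')
qed

lemma topspace_alexandroff_duplicate [simp]: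
  "topspace (alexandroff_duplicate X) = topspace X \<times> UNIV"
proof
  show "topspace (alexandroff_duplicate X) \<subseteq> topspace X \<times> UNIV"
    using openin_topspace[of "alexandroff_duplicate X"]
    unfolding openin_alexandroff_duplicate by blast
  have "openin (alexandroff_duplicate X) (topspace X \<times> UNIV)"
    unfolding openin_alexandroff_duplicate by (auto intro!: exI[of _ "topspace X"])
  then show "topspace X \<times> UNIV \<subseteq> topspace (alexandroff_duplicate X)"
    by (rule openin_subset)
qed

definition sigma_product :: "('i \<Rightarrow> 'b topology) \<Rightarrow> 'i set \<Rightarrow> ('i \<Rightarrow> 'b) \<Rightarrow> ('i \<Rightarrow> 'b) set" where
  "sigma_product X \<Gamma> a =
     {x \<in> topspace (product_topology X \<Gamma>). finite {\<gamma> \<in> \<Gamma>. x \<gamma> \<noteq> a \<gamma>}}"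

definition hilbert_cube :: "(nat \<Rightarrow> real) topology" where
  "hilbert_cube = product_topology (\<lambda>_. top_of_set {0..1}) UNIV"

text \<open>
  A definition cannot quantify over types, so the index sets are taken inside the type
  \<open>'a \<times> 'a\<close> (with \<open>'a\<close> the type of points of \<open>K\<close>), and compact metrizable spaces
  inside \<open>nat \<Rightarrow> real\<close>, with arbitrary topologies. This is no restriction: the lemmas
  \<open>NY_compactI\<close> and \<open>NY_ValdiviaI\<close> below derive the two properties from embeddings
  with index sets and factor spaces in arbitrary types.
\<close>

definition NY_compact :: "'a topology \<Rightarrow> bool" where
  "NY_compact K \<longleftrightarrow> compact_space K \<and> Hausdorff_space K \<and>
     (\<exists>(\<Gamma> :: ('a \<times> 'a) set) (X :: 'a \<times> 'a \<Rightarrow> (nat \<Rightarrow> real) topology) a h.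
        (\<forall>\<gamma>\<in>\<Gamma>. compact_space (X \<gamma>) \<and> metrizable_space (X \<gamma>)) \<and>
        a \<in> topspace (product_topology X \<Gamma>) \<and>
        embedding_map K (subtopology (product_topology X \<Gamma>) (sigma_product X \<Gamma> a)) h)"

definition NY_Valdivia :: "'a topology \<Rightarrow> bool" where
  "NY_Valdivia K \<longleftrightarrow> compact_space K \<and> Hausdorff_space K \<and>
     (\<exists>(\<Gamma> :: ('a \<times> 'a) set) h.
        embedding_map K (product_topology (\<lambda>_. hilbert_cube) \<Gamma>) h \<and>
        (subtopology (product_topology (\<lambda>_. hilbert_cube) \<Gamma>) (h ` topspace K)) closure_of
          (h ` topspace K \<inter> sigma_product (\<lambda>_. hilbert_cube) \<Gamma> (\<lambda>\<gamma>\<in>\<Gamma>. \<lambda>n. 0))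
        = h ` topspace K)"

lemma Hausdorff_hilbert_cube: "Hausdorff_space hilbert_cube"
  unfolding hilbert_cube_def
  by (simp add: Hausdorff_space_product_topology Hausdorff_space_subtopology)

lemma metrizable_hilbert_cube: "metrizable_space hilbert_cube"
  unfolding hilbert_cube_def
  by (simp add: metrizable_space_product_topology metrizable_space_subtopology
      metrizable_space_euclidean)

lemma compact_metrizable_embeds_hilbert_cube:
  assumes "compact_space X" "metrizable_space X"
  shows "\<exists>f. embedding_map X hilbert_cube f"
proof -
  obtain M d where Md: "Metric_space M d" and X: "X = Metric_space.mtopology M d"
    using assms(2) unfolding metrizable_space_def by blast
  interpret Metric_space M d by (rule Md)
  have tb: "mtotally_bounded M"
    using assms(1) X compact_space_eq_mcomplete_mtotally_bounded by blast
  define C where "C n = (SOME C. finite C \<and> C \<subseteq> M \<and> M \<subseteq> (\<Union>x\<in>C. mball x (1 / real (Suc n))))" for n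
  have C: "finite (C n) \<and> C n \<subseteq> M \<and> M \<subseteq> (\<Union>x\<in>C n. mball x (1 / real (Suc n)))" for n
    unfolding C_def
    by (rule someI_ex) (use tb in \<open>auto simp: mtotally_bounded_def\<close>)
  define Q where "Q = (\<Union>n. C n)"
  have "countable Q" unfolding Q_def using C by (simp add: countable_finite)
  have QM: "Q \<subseteq> M" unfolding Q_def using C by blast
  define q where "q = from_nat_into Q"
  define f where "f x = (\<lambda>n. if q n \<in> M then min 1 (d (q n) x) else 0)" for x
  have cont: "continuous_map X hilbert_cube f"
    unfolding hilbert_cube_def continuous_map_componentwise_UNIV
  proof
    fix n
    have "continuous_map X euclideanreal (\<lambda>x. f x n)"
    proof (cases "q n \<in> M")
      case True
      have "continuous_map X euclideanreal (\<lambda>x. d (q n) x)"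
        using True continuous_on_mdist[of "q n" "metric (M, d)"]
        by (simp add: X mtopology_of_def)
      then show ?thesis
        using True by (simp add: f_def continuous_map_real_min)
    next
      case False
      then show ?thesis by (simp add: f_def)
    qed
    then show "continuous_map X (top_of_set {0..1}) (\<lambda>x. f x n)"
      by (auto simp: continuous_map_in_subtopology f_def)
  qed
  have inj: "inj_on f (topspace X)"
  proof (rule inj_onI, rule ccontr)
    fix x y assume xy: "x \<in> topspace X" "y \<in> topspace X" "f x = f y" "x \<noteq> y"
    then have M: "x \<in> M" "y \<in> M" by (auto simp: X)
    define e where "e = min 1 (d x y / 2)"
    have "e > 0" using M xy by (simp add: e_def)
    then obtain n where n: "1 / real (Suc n) < e" using nat_approx_posE by blast
    obtain z where z: "z \<in> C n" "d z x < 1 / real (Suc n)" using C[of n] M by (auto simp: subset_iff)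
    then have "z \<in> Q" by (auto simp: Q_def)
    then obtain k where k: "q k = z"
      using \<open>countable Q\<close> unfolding q_def by (metis from_nat_into_surj)
    have "z \<in> M" using \<open>z \<in> Q\<close> QM by blast
    have "d z x < e" using z n by linarith
    then have "d z x < 1" "d z x < d x y / 2" by (auto simp: e_def)
    moreover have "min 1 (d z x) = min 1 (d z y)"
      using xy(3) k \<open>z \<in> M\<close> unfolding f_def by (metis (full_types))
    ultimately have "d z y = d z x" by linarith
    moreover have "d x y \<le> d x z + d z y" using M \<open>z \<in> M\<close> by (simp add: triangle)
    ultimately show False using \<open>d z x < d x y / 2\<close> commute[of x z] by linarith
  qed
  show ?thesis
    using continuous_imp_embedding_map[OF cont assms(1) Hausdorff_hilbert_cube inj] by blast
qed

text \<open>An injection into a product stays injective on a small set of coordinates.\<close>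

lemma separating_coordinates:
  fixes S :: "'a set" and h :: "'a \<Rightarrow> 'i \<Rightarrow> 'b"
  assumes "inj_on h S" "\<And>x. x \<in> S \<Longrightarrow> h x \<in> extensional \<Gamma>"
  obtains \<Delta> :: "('a \<times> 'a) set" and g :: "'a \<times> 'a \<Rightarrow> 'i"
  where "inj_on g \<Delta>" "g ` \<Delta> \<subseteq> \<Gamma>"
    "\<And>x y. \<lbrakk>x \<in> S; y \<in> S; x \<noteq> y\<rbrakk> \<Longrightarrow> \<exists>p\<in>\<Delta>. h x (g p) \<noteq> h y (g p)"
proof -
  define D where "D = {(x, y). x \<in> S \<and> y \<in> S \<and> x \<noteq> y}"
  have "\<exists>\<gamma>\<in>\<Gamma>. h x \<gamma> \<noteq> h y \<gamma>" if "(x, y) \<in> D" for x y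
    using that assms unfolding D_def
    by (metis (mono_tags, lifting) case_prodD extensionalityI inj_onD mem_Collect_eq)
  then have "\<forall>p\<in>D. \<exists>\<gamma>. \<gamma> \<in> \<Gamma> \<and> h (fst p) \<gamma> \<noteq> h (snd p) \<gamma>"
    by (metis prod.collapse)
  then obtain g where g: "\<forall>p\<in>D. g p \<in> \<Gamma> \<and> h (fst p) (g p) \<noteq> h (snd p) (g p)"
    by metis
  obtain \<Delta> where \<Delta>: "\<Delta> \<subseteq> D" "inj_on g \<Delta>" "g ` \<Delta> = g ` D"
    by (metis subset_image_inj subset_refl)
  show thesis
  proof
    show "inj_on g \<Delta>" "g ` \<Delta> \<subseteq> \<Gamma>" using \<Delta> g by auto
    fix x y assume "x \<in> S" "y \<in> S" "x \<noteq> y"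
    then have "(x, y) \<in> D" by (simp add: D_def)
    then have "g (x, y) \<in> g ` \<Delta>" using \<Delta> by blast
    then obtain p where "p \<in> \<Delta>" "g p = g (x, y)" by auto
    then show "\<exists>p\<in>\<Delta>. h x (g p) \<noteq> h y (g p)" using g \<open>(x, y) \<in> D\<close> by force
  qed
qed

lemma finite_reindex:
  assumes "finite {\<gamma> \<in> \<Gamma>. P \<gamma>}" "inj_on g \<Delta>" "g ` \<Delta> \<subseteq> \<Gamma>" "\<And>p. p \<in> \<Delta> \<Longrightarrow> R p \<Longrightarrow> P (g p)"
  shows "finite {p \<in> \<Delta>. R p}"
proof (rule finite_imageD)
  show "finite (g ` {p \<in> \<Delta>. R p})"
    by (rule finite_subset[OF _ assms(1)]) (use assms in auto)
  show "inj_on g {p \<in> \<Delta>. R p}" using assms(2) by (auto simp: inj_on_def)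
qed

theorem NY_compactI:
  fixes K :: "'a topology" and \<Gamma> :: "'i set" and X :: "'i \<Rightarrow> 'b topology"
  assumes K: "compact_space K" "Hausdorff_space K"
    and X: "\<And>\<gamma>. \<gamma> \<in> \<Gamma> \<Longrightarrow> compact_space (X \<gamma>) \<and> metrizable_space (X \<gamma>)"
    and a: "a \<in> topspace (product_topology X \<Gamma>)"
    and h: "embedding_map K (subtopology (product_topology X \<Gamma>) (sigma_product X \<Gamma> a)) h"
  shows "NY_compact K"
proof -
  have "\<forall>\<gamma>\<in>\<Gamma>. \<exists>f. embedding_map (X \<gamma>) hilbert_cube f"
    using X compact_metrizable_embeds_hilbert_cube by blast
  then obtain f where f: "\<And>\<gamma>. \<gamma> \<in> \<Gamma> \<Longrightarrow> embedding_map (X \<gamma>) hilbert_cube (f \<gamma>)"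
    by metis
  have hc: "continuous_map K (subtopology (product_topology X \<Gamma>) (sigma_product X \<Gamma> a)) h"
    and hi: "inj_on h (topspace K)"
    using h unfolding embedding_map_def homeomorphic_eq_everything_map
    by (auto dest: continuous_map_into_fulltopology)
  have hp: "continuous_map K (product_topology X \<Gamma>) h"
    and hs: "\<And>x. x \<in> topspace K \<Longrightarrow> h x \<in> sigma_product X \<Gamma> a"
    using hc by (auto simp: continuous_map_in_subtopology)
  have he: "\<And>x. x \<in> topspace K \<Longrightarrow> h x \<in> (\<Pi>\<^sub>E \<gamma>\<in>\<Gamma>. topspace (X \<gamma>))"
    using hs by (auto simp: sigma_product_def)
  have hx: "\<And>x. x \<in> topspace K \<Longrightarrow> h x \<in> extensional \<Gamma>"
    using he by (auto simp: PiE_iff)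
  obtain \<Delta> :: "('a \<times> 'a) set" and g where g: "inj_on g \<Delta>" "g ` \<Delta> \<subseteq> \<Gamma>"
    and sep: "\<And>x y. \<lbrakk>x \<in> topspace K; y \<in> topspace K; x \<noteq> y\<rbrakk> \<Longrightarrow> \<exists>p\<in>\<Delta>. h x (g p) \<noteq> h y (g p)"
    by (rule separating_coordinates[OF hi hx]) blast+
  define Y where "Y p = subtopology hilbert_cube (f (g p) ` topspace (X (g p)))" for p
  define b where "b = (\<lambda>p\<in>\<Delta>. f (g p) (a (g p)))"
  define k where "k x = (\<lambda>p\<in>\<Delta>. f (g p) (h x (g p)))" for x
  have gG: "g p \<in> \<Gamma>" if "p \<in> \<Delta>" for p using that g by blast
  have fh: "homeomorphic_map (X (g p)) (Y p) (f (g p))" if "p \<in> \<Delta>" for p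
    using f[OF gG[OF that]] by (simp add: embedding_map_def Y_def)
  have Y: "compact_space (Y p) \<and> metrizable_space (Y p)" if "p \<in> \<Delta>" for p
    using X[OF gG[OF that]] fh[OF that]
    by (metis homeomorphic_compact_space homeomorphic_map_imp_homeomorphic_space
        homeomorphic_metrizable_space)
  have finj: "inj_on (f (g p)) (topspace (X (g p)))" if "p \<in> \<Delta>" for p
    using fh[OF that] homeomorphic_imp_injective_map by blast
  have ftop: "topspace (Y p) = f (g p) ` topspace (X (g p))" if "p \<in> \<Delta>" for p
    using fh[OF that] homeomorphic_imp_surjective_map by blast
  have b: "b \<in> topspace (product_topology Y \<Delta>)"
    using a gG by (auto simp: b_def ftop PiE_iff)
  have kc: "continuous_map K (product_topology Y \<Delta>) k"
    unfolding continuous_map_componentwise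
  proof (intro conjI ballI)
    show "k ` topspace K \<subseteq> extensional \<Delta>" by (auto simp: k_def)
    fix p assume p: "p \<in> \<Delta>"
    have "continuous_map K (X (g p)) (\<lambda>x. h x (g p))"
      using hp gG[OF p] by (simp add: continuous_map_componentwise)
    then have "continuous_map K (Y p) (f (g p) \<circ> (\<lambda>x. h x (g p)))"
      using fh[OF p] continuous_map_compose homeomorphic_imp_continuous_map by blast
    then show "continuous_map K (Y p) (\<lambda>x. k x p)"
      using p by (simp add: k_def o_def)
  qed
  have ks: "k x \<in> sigma_product Y \<Delta> b" if x: "x \<in> topspace K" for x
  proof -
    have "k x \<in> topspace (product_topology Y \<Delta>)"
      using kc x continuous_map_image_subset_topspace by blast
    moreover have "finite {p \<in> \<Delta>. k x p \<noteq> b p}"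
    proof (rule finite_reindex[OF _ g])
      show "finite {\<gamma> \<in> \<Gamma>. h x \<gamma> \<noteq> a \<gamma>}" using hs[OF x] by (simp add: sigma_product_def)
    qed (auto simp: k_def b_def)
    ultimately show ?thesis by (simp add: sigma_product_def)
  qed
  have ki: "inj_on k (topspace K)"
  proof (rule inj_onI, rule ccontr)
    fix x y assume xy: "x \<in> topspace K" "y \<in> topspace K" "k x = k y" "x \<noteq> y"
    then obtain p where p: "p \<in> \<Delta>" "h x (g p) \<noteq> h y (g p)" using sep by blast
    have "f (g p) (h x (g p)) = f (g p) (h y (g p))"
      using fun_cong[OF xy(3), of p] p by (simp add: k_def)
    then show False
      using inj_onD[OF finj[OF p(1)]] p he[OF xy(1)] he[OF xy(2)] gG[OF p(1)] by blast
  qed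
  have "Hausdorff_space (subtopology (product_topology Y \<Delta>) (sigma_product Y \<Delta> b))"
    using Y by (auto intro!: Hausdorff_space_subtopology
        simp: Hausdorff_space_product_topology metrizable_imp_Hausdorff_space)
  moreover have "continuous_map K (subtopology (product_topology Y \<Delta>) (sigma_product Y \<Delta> b)) k"
    using kc ks by (auto simp: continuous_map_in_subtopology)
  ultimately have "embedding_map K (subtopology (product_topology Y \<Delta>) (sigma_product Y \<Delta> b)) k"
    using continuous_imp_embedding_map K(1) ki by blast
  then show ?thesis
    unfolding NY_compact_def using K Y b by blast
qed

theorem NY_ValdiviaI:
  fixes K :: "'a topology" and \<Gamma> :: "'i set"
  assumes K: "compact_space K" "Hausdorff_space K"
    and h: "embedding_map K (product_topology (\<lambda>_. hilbert_cube) \<Gamma>) h"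
    and dense: "(subtopology (product_topology (\<lambda>_. hilbert_cube) \<Gamma>) (h ` topspace K)) closure_of
          (h ` topspace K \<inter> sigma_product (\<lambda>_. hilbert_cube) \<Gamma> (\<lambda>\<gamma>\<in>\<Gamma>. \<lambda>n. 0))
        = h ` topspace K"
  shows "NY_Valdivia K"
proof -
  let ?P = "product_topology (\<lambda>_. hilbert_cube) \<Gamma>"
  let ?s = "sigma_product (\<lambda>_. hilbert_cube) \<Gamma> (\<lambda>\<gamma>\<in>\<Gamma>. \<lambda>n. 0)"
  have hh: "homeomorphic_map K (subtopology ?P (h ` topspace K)) h"
    using h by (simp add: embedding_map_def)
  have hp: "continuous_map K ?P h" and hi: "inj_on h (topspace K)"
    using hh unfolding homeomorphic_eq_everything_map
    by (auto dest: continuous_map_into_fulltopology)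
  have he: "\<And>x. x \<in> topspace K \<Longrightarrow> h x \<in> (\<Pi>\<^sub>E \<gamma>\<in>\<Gamma>. topspace hilbert_cube)"
    using hp continuous_map_image_subset_topspace by fastforce
  have hx: "\<And>x. x \<in> topspace K \<Longrightarrow> h x \<in> extensional \<Gamma>"
    using he by (auto simp: PiE_iff)
  obtain \<Delta> :: "('a \<times> 'a) set" and g where g: "inj_on g \<Delta>" "g ` \<Delta> \<subseteq> \<Gamma>"
    and sep: "\<And>x y. \<lbrakk>x \<in> topspace K; y \<in> topspace K; x \<noteq> y\<rbrakk> \<Longrightarrow> \<exists>p\<in>\<Delta>. h x (g p) \<noteq> h y (g p)"
    by (rule separating_coordinates[OF hi hx]) blast+
  let ?R = "product_topology (\<lambda>_. hilbert_cube) \<Delta>"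
  let ?t = "sigma_product (\<lambda>_. hilbert_cube) \<Delta> (\<lambda>\<gamma>\<in>\<Delta>. \<lambda>n. 0)"
  define k where "k x = (\<lambda>p\<in>\<Delta>. h x (g p))" for x
  have gG: "g p \<in> \<Gamma>" if "p \<in> \<Delta>" for p using that g by blast
  have kc: "continuous_map K ?R k"
    unfolding continuous_map_componentwise
  proof (intro conjI ballI)
    show "k ` topspace K \<subseteq> extensional \<Delta>" by (auto simp: k_def)
    fix p assume p: "p \<in> \<Delta>"
    then show "continuous_map K hilbert_cube (\<lambda>x. k x p)"
      using hp gG[OF p] by (simp add: continuous_map_componentwise k_def)
  qed
  have ki: "inj_on k (topspace K)"
  proof (rule inj_onI, rule ccontr)
    fix x y assume xy: "x \<in> topspace K" "y \<in> topspace K" "k x = k y" "x \<noteq> y"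
    then obtain p where p: "p \<in> \<Delta>" "h x (g p) \<noteq> h y (g p)" using sep by blast
    then show False using fun_cong[OF xy(3), of p] by (simp add: k_def)
  qed
  have "Hausdorff_space ?R"
    by (simp add: Hausdorff_space_product_topology Hausdorff_hilbert_cube)
  then have ke: "embedding_map K ?R k"
    using continuous_imp_embedding_map K(1) ki kc by blast
  then have kh: "homeomorphic_map K (subtopology ?R (k ` topspace K)) k"
    by (simp add: embedding_map_def)
  define A where "A = {x \<in> topspace K. h x \<in> ?s}"
  have A: "A \<subseteq> topspace K" by (auto simp: A_def)
  have "h ` A = h ` topspace K \<inter> ?s" by (auto simp: A_def)
  then have "h ` (K closure_of A) = h ` topspace K"
    using homeomorphic_map_closure_of[OF hh A] dense by simp
  then have KA: "K closure_of A = topspace K"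
    using hi by (simp add: inj_on_image_eq_iff[OF hi] closure_of_subset_topspace)
  have "k ` A \<subseteq> k ` topspace K \<inter> ?t"
  proof
    fix z assume "z \<in> k ` A"
    then obtain x where x: "x \<in> topspace K" "h x \<in> ?s" "z = k x" by (auto simp: A_def)
    have "k x \<in> topspace ?R" using kc x continuous_map_image_subset_topspace by blast
    moreover have "finite {p \<in> \<Delta>. k x p \<noteq> (\<lambda>\<gamma>\<in>\<Delta>. \<lambda>n. 0) p}"
    proof (rule finite_reindex[OF _ g])
      show "finite {\<gamma> \<in> \<Gamma>. h x \<gamma> \<noteq> (\<lambda>\<gamma>\<in>\<Gamma>. \<lambda>n. 0) \<gamma>}" using x by (simp add: sigma_product_def)
    qed (use gG in \<open>auto simp: k_def\<close>)
    ultimately show "z \<in> k ` topspace K \<inter> ?t" using x by (simp add: sigma_product_def)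
  qed
  then have "subtopology ?R (k ` topspace K) closure_of (k ` A)
      \<subseteq> subtopology ?R (k ` topspace K) closure_of (k ` topspace K \<inter> ?t)"
    by (rule closure_of_mono)
  moreover have "subtopology ?R (k ` topspace K) closure_of (k ` A) = k ` topspace K"
    using homeomorphic_map_closure_of[OF kh A] KA by simp
  moreover have "subtopology ?R (k ` topspace K) closure_of (k ` topspace K \<inter> ?t) \<subseteq> k ` topspace K"
    using closure_of_subset_topspace[of "subtopology ?R (k ` topspace K)"]
    by (auto simp: topspace_subtopology)
  ultimately have "subtopology ?R (k ` topspace K) closure_of (k ` topspace K \<inter> ?t) = k ` topspace K"
    by blast
  then show ?thesis
    unfolding NY_Valdivia_def using K ke by blast
qed

end

theory Submission
  imports Defs
begin

text \<open>
  The equivalences are proved as a cycle: \<open>K\<close> NY compact implies \<open>AD(K)\<close> NY compact, which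
  implies \<open>AD(K)\<close> NY-Valdivia, which implies \<open>K\<close> NY compact. Being NY compact amounts to having a
  separating family of continuous maps into the Hilbert cube of which only finitely many are nonzero
  at each point (\<open>sigma_coordinates\<close>). To such a family on \<open>K\<close> one adds the indicators of the
  isolated points \<open>(x,1)\<close> and gets one on \<open>AD(K)\<close>; and an embedding of \<open>AD(K)\<close> whose whole image
  lies in the \<open>\<sigma>\<close>-product meets it in a dense set.

  The content is in the last implication. A dense set contains all isolated points, so in a
  Valdivia embedding \<open>h\<close> of \<open>AD(K)\<close> every \<open>(x,1)\<close> has finite support. The points \<open>(x,0)\<close> may have
  infinite support; let \<open>B\<close> be the set of these bad points \<open>x\<close>. Two facts make them harmless. First,
  a bad point is a \<open>G\<^sub>\<delta>\<close> point: take infinitely many \<open>\<gamma>\<close> in the support of \<open>(y,0)\<close> and for each a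
  neighborhood \<open>U\<close> of \<open>y\<close> with \<open>(U \<times> {0,1}) - {(y,1)}\<close> inside \<open>{h\<^sub>\<gamma> \<noteq> 0}\<close>; a point \<open>x \<noteq> y\<close>
  in all these \<open>U\<close> would give \<open>(x,1)\<close> infinite support. Secondly, let \<open>D\<^sub>\<gamma>\<close> be the set of bad
  points \<open>y\<close> with \<open>h\<^sub>\<gamma>(y,0) \<noteq> 0\<close> and \<open>h\<^sub>\<gamma>(y,1) = 0\<close>. By compactness only finitely many points of
  \<open>D\<^sub>\<gamma>\<close> lie in a compact part of the cozero set \<open>W\<^sub>\<gamma>\<close> of \<open>h\<^sub>\<gamma>(\<cdot>,0)\<close>
  (\<open>finite_exceptions_AD\<close>). Together these say that \<open>W\<^sub>\<gamma> - D\<^sub>\<gamma>\<close> is again a cozero set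
  (\<open>zero_function_with_extra_zeros\<close>), and the family of these sets is point-finite: if a bad
  point \<open>x\<close> lies in \<open>W\<^sub>\<gamma> - D\<^sub>\<gamma>\<close>, then \<open>\<gamma>\<close> is in the finite support of \<open>(x,1)\<close>.

  Cutting \<open>h\<^sub>\<gamma>(\<cdot>,0)\<close> down to \<open>W\<^sub>\<gamma> - D\<^sub>\<gamma>\<close> therefore restores finite supports, and still separates
  points outside \<open>B\<close>. To recover a bad point \<open>y\<close>, choose one \<open>\<gamma>\<close> with \<open>y \<in> D\<^sub>\<gamma>\<close> and add a
  function that is positive at \<open>y\<close> and vanishes off \<open>W\<^sub>\<gamma>\<close> and on \<open>D\<^sub>\<gamma> - {y}\<close>; a cut-off in terms
  of the size of \<open>h\<^sub>\<gamma>\<close> makes the functions belonging to the same \<open>\<gamma>\<close> point-finite. This is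
  \<open>NY_compact_if_finite_support_on_isolated\<close>.
\<close>

section \<open>Functions to the unit interval with prescribed zeros\<close>

abbreviation unit_map :: "'a topology \<Rightarrow> ('a \<Rightarrow> real) \<Rightarrow> bool" where
  "unit_map K f \<equiv> continuous_map K (top_of_set {0..1}) f"

lemma unit_map_iff:
  "unit_map K f \<longleftrightarrow> continuous_map K euclideanreal f \<and> (\<forall>x\<in>topspace K. 0 \<le> f x \<and> f x \<le> 1)"
  by (auto simp: continuous_map_in_subtopology Pi_iff)

lemma unit_map_mult: "unit_map K f \<Longrightarrow> unit_map K g \<Longrightarrow> unit_map K (\<lambda>x. f x * g x)"
  by (simp add: unit_map_iff continuous_map_real_mult mult_le_one)

lemma unit_map_pos_part:
  assumes "continuous_map K euclideanreal f" "\<And>x. x \<in> topspace K \<Longrightarrow> f x \<le> 1"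
  shows "unit_map K (\<lambda>x. max 0 (f x))"
  using assms by (auto simp: unit_map_iff intro!: continuous_map_real_max)

lemma continuous_map_hilbert_cube_iff:
  "continuous_map K hilbert_cube f \<longleftrightarrow> (\<forall>n. unit_map K (\<lambda>x. f x n))"
  by (simp add: hilbert_cube_def continuous_map_componentwise_UNIV)

text \<open>
  The given functions form a map into the Hilbert cube; compose it with the distance from the origin
  in a compatible metric.
\<close>

lemma common_zero_function:
  fixes \<phi> :: "nat \<Rightarrow> 'a \<Rightarrow> real"
  assumes "\<And>n. unit_map K (\<phi> n)"
  shows "\<exists>g. unit_map K g \<and> (\<forall>x\<in>topspace K. g x = 0 \<longleftrightarrow> (\<forall>n. \<phi> n x = 0))"
proof -
  obtain M d where Md: "Metric_space M d" and Q: "hilbert_cube = Metric_space.mtopology M d"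
    using metrizable_hilbert_cube unfolding metrizable_space_def by blast
  interpret Metric_space M d by (rule Md)
  let ?o = "\<lambda>n::nat. 0::real"
  have "?o \<in> topspace hilbert_cube"
    by (simp add: hilbert_cube_def PiE_UNIV_domain)
  then have o: "?o \<in> M" by (simp add: Q)
  have \<Phi>: "continuous_map K hilbert_cube (\<lambda>x n. \<phi> n x)"
    using assms by (simp add: continuous_map_hilbert_cube_iff)
  have w: "continuous_map hilbert_cube euclideanreal (d ?o)"
    using o continuous_on_mdist[of ?o "metric (M, d)"] by (simp add: Q mtopology_of_def)
  have c: "continuous_map K euclideanreal (\<lambda>x. d ?o (\<lambda>n. \<phi> n x))"
    using continuous_map_compose[OF \<Phi> w] by (simp add: o_def)
  have m: "(\<lambda>n. \<phi> n x) \<in> M" if "x \<in> topspace K" for x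
    using continuous_map_image_subset_topspace[OF \<Phi>] that by (auto simp: Q)
  show ?thesis
  proof (intro exI conjI ballI)
    show "unit_map K (\<lambda>x. min 1 (d ?o (\<lambda>n. \<phi> n x)))"
      using c by (simp add: unit_map_iff continuous_map_real_min)
    show "min 1 (d ?o (\<lambda>n. \<phi> n x)) = 0 \<longleftrightarrow> (\<forall>n. \<phi> n x = 0)" if "x \<in> topspace K" for x
    proof -
      have "min 1 (d ?o (\<lambda>n. \<phi> n x)) = 0 \<longleftrightarrow> d ?o (\<lambda>n. \<phi> n x) = 0" by linarith
      then show ?thesis using m[OF that] o by (auto simp: fun_eq_iff)
    qed
  qed
qed

text \<open>
  Each \<open>U n\<close> contributes a function vanishing at \<open>y\<close> and equal to \<open>1\<close> outside \<open>U n\<close>; their common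
  zeros lie in the intersection of the \<open>U n\<close>.
\<close>

lemma Gdelta_point_zero_function:
  assumes K: "compact_space K" "Hausdorff_space K" and y: "y \<in> topspace K"
    and U: "\<And>n::nat. openin K (U n)" "\<And>n. y \<in> U n" "(\<Inter>n. U n) \<subseteq> {y}"
  shows "\<exists>\<theta>. unit_map K \<theta> \<and> (\<forall>x\<in>topspace K. \<theta> x = 0 \<longleftrightarrow> x = y)"
proof -
  have "completely_regular_space K"
    using K compact_Hausdorff_or_regular_imp_normal_space normal_imp_completely_regular_space by blast
  then have "\<exists>f. unit_map K f \<and> f y = 0 \<and> f ` (topspace K - U n) \<subseteq> {1}" for n
    using y U unfolding completely_regular_space_def by blast
  then obtain f where f: "\<And>n. unit_map K (f n)" "\<And>n. f n y = 0"
      "\<And>n. f n ` (topspace K - U n) \<subseteq> {1}" by metis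
  obtain \<theta> where \<theta>: "unit_map K \<theta>" "\<And>x. x \<in> topspace K \<Longrightarrow> \<theta> x = 0 \<longleftrightarrow> (\<forall>n. f n x = 0)"
    using common_zero_function[of K f, OF f(1)] by blast
  show ?thesis
  proof (intro exI conjI ballI)
    fix x assume x: "x \<in> topspace K"
    have "x = y" if "\<forall>n. f n x = 0"
    proof -
      have "x \<in> U n" for n using f(3)[of n] that x by force
      then show ?thesis using U(3) by blast
    qed
    then show "\<theta> x = 0 \<longleftrightarrow> x = y" using \<theta>(2)[OF x] f(2) by blast
  qed (rule \<theta>(1))
qed

text \<open>
  The cozero set of \<open>u\<close> stays a cozero set after removing a set \<open>E\<close> of \<open>G\<^sub>\<delta>\<close> points that is finite on
  every level \<open>{u \<ge> \<epsilon>}\<close>. On the set where \<open>u > 1/(n+1)\<close> only the finitely many points of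
  \<open>E\<close> in that level have to be removed, which a finite product of the \<open>\<theta> y\<close> does; the common zeros of
  these countably many truncated functions are the required ones.
\<close>

lemma zero_function_with_extra_zeros:
  assumes u: "unit_map K u"
    and fin: "\<And>\<epsilon>. \<epsilon> > 0 \<Longrightarrow> finite {y \<in> E. \<epsilon> \<le> u y}"
    and \<theta>: "\<And>y. y \<in> E \<Longrightarrow> unit_map K (\<theta> y)"
      "\<And>y x. y \<in> E \<Longrightarrow> x \<in> topspace K \<Longrightarrow> \<theta> y x = 0 \<longleftrightarrow> x = y"
  shows "\<exists>g. unit_map K g \<and> (\<forall>x\<in>topspace K. g x = 0 \<longleftrightarrow> u x = 0 \<or> x \<in> E)"
proof -
  define F where "F n = {y \<in> E. 1 / real (Suc n) \<le> u y}" for n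
  define \<phi> where "\<phi> n x = max 0 (u x - 1 / real (Suc n)) * (\<Prod>y\<in>F n. \<theta> y x)" for n x
  have F: "finite (F n)" for n
    unfolding F_def by (rule fin) simp
  have "unit_map K (\<phi> n)" for n
    unfolding \<phi>_def
  proof (rule unit_map_mult)
    have "u x \<le> 1 + 1 / real (Suc n)" if "x \<in> topspace K" for x
      using u that by (simp add: unit_map_iff add_increasing2)
    then show "unit_map K (\<lambda>x. max 0 (u x - 1 / real (Suc n)))"
      using u by (intro unit_map_pos_part)
        (auto simp: unit_map_iff algebra_simps intro!: continuous_map_diff)
    show "unit_map K (\<lambda>x. \<Prod>y\<in>F n. \<theta> y x)"
      unfolding unit_map_iff
      using \<theta>(1) F by (auto simp: F_def unit_map_iff intro!: continuous_map_prod prod_nonneg prod_le_1)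
  qed
  then obtain g where g: "unit_map K g" "\<And>x. x \<in> topspace K \<Longrightarrow> g x = 0 \<longleftrightarrow> (\<forall>n. \<phi> n x = 0)"
    using common_zero_function[of K \<phi>] by blast
  show ?thesis
  proof (intro exI conjI ballI)
    fix x assume x: "x \<in> topspace K"
    have nn: "0 \<le> u x" using u x by (simp add: unit_map_iff)
    have z: "\<phi> n x = 0 \<longleftrightarrow> u x \<le> 1 / real (Suc n) \<or> x \<in> F n" for n
      using \<theta>(2)[OF _ x] F[of n] by (auto simp: \<phi>_def F_def max_def)
    show "g x = 0 \<longleftrightarrow> u x = 0 \<or> x \<in> E"
    proof
      assume "g x = 0"
      then have a: "\<forall>n. u x \<le> 1 / real (Suc n) \<or> x \<in> F n" using g(2)[OF x] z by simp
      show "u x = 0 \<or> x \<in> E"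
      proof (rule ccontr)
        assume n: "\<not> ?thesis"
        then obtain n where "1 / real (Suc n) < u x" using nn nat_approx_posE[of "u x"] by auto
        then show False using a n by (auto simp: F_def not_le[symmetric])
      qed
    next
      assume b: "u x = 0 \<or> x \<in> E"
      have "u x \<le> 1 / real (Suc n) \<or> x \<in> F n" for n
        using b by (auto simp: F_def)
      then show "g x = 0" using g(2)[OF x] z by simp
    qed
  qed (rule g(1))
qed

section \<open>Point-finite separating families and the two classes of compacta\<close>

text \<open>
  The coordinates of an embedding into the \<open>\<sigma>\<close>-product of Hilbert cubes based at the origin, without
  the restriction of \<open>k x\<close> to the index set.
\<close>

definition sigma_coordinates ::
    "'a topology \<Rightarrow> 'j set \<Rightarrow> ('a \<Rightarrow> 'j \<Rightarrow> nat \<Rightarrow> real) \<Rightarrow> bool" where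
  "sigma_coordinates K J k \<longleftrightarrow>
     (\<forall>j\<in>J. continuous_map K hilbert_cube (\<lambda>x. k x j)) \<and>
     (\<forall>x\<in>topspace K. finite {j \<in> J. k x j \<noteq> (\<lambda>n. 0)}) \<and>
     (\<forall>x\<in>topspace K. \<forall>y\<in>topspace K. x \<noteq> y \<longrightarrow> (\<exists>j\<in>J. k x j \<noteq> k y j))"

lemma sigma_coordinates_embedding:
  assumes K: "compact_space K" and k: "sigma_coordinates K J k"
  shows "embedding_map K (product_topology (\<lambda>_. hilbert_cube) J) (\<lambda>x. restrict (k x) J)"
    and "(\<lambda>x. restrict (k x) J) ` topspace K
           \<subseteq> sigma_product (\<lambda>_. hilbert_cube) J (\<lambda>j\<in>J. \<lambda>n. 0)"
proof -
  let ?P = "product_topology (\<lambda>_. hilbert_cube) J"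
  let ?k = "\<lambda>x. restrict (k x) J"
  have c: "continuous_map K ?P ?k"
    using k unfolding continuous_map_componentwise sigma_coordinates_def by auto
  have i: "inj_on ?k (topspace K)"
  proof (rule inj_onI, rule ccontr)
    fix x y assume xy: "x \<in> topspace K" "y \<in> topspace K" "?k x = ?k y" "x \<noteq> y"
    then obtain j where "j \<in> J" "k x j \<noteq> k y j"
      using k unfolding sigma_coordinates_def by meson
    then show False using fun_cong[OF xy(3), of j] by simp
  qed
  have "Hausdorff_space ?P"
    by (simp add: Hausdorff_space_product_topology Hausdorff_hilbert_cube)
  then show "embedding_map K ?P ?k"
    using continuous_imp_embedding_map[OF c K _ i] by blast
  have "finite {j \<in> J. ?k x j \<noteq> (\<lambda>j\<in>J. \<lambda>n. 0) j}" if "x \<in> topspace K" for x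
  proof -
    have "{j \<in> J. ?k x j \<noteq> (\<lambda>j\<in>J. \<lambda>n. 0) j} = {j \<in> J. k x j \<noteq> (\<lambda>n. 0)}" by auto
    then show ?thesis using k that unfolding sigma_coordinates_def by simp
  qed
  then show "?k ` topspace K \<subseteq> sigma_product (\<lambda>_. hilbert_cube) J (\<lambda>j\<in>J. \<lambda>n. 0)"
    using continuous_map_image_subset_topspace[OF c] unfolding sigma_product_def by blast
qed

lemma compact_hilbert_cube: "compact_space hilbert_cube"
  by (simp add: hilbert_cube_def compact_space_product_topology compact_space_subtopology)

lemma NY_compact_if_sigma_coordinates:
  assumes K: "compact_space K" "Hausdorff_space K" and k: "sigma_coordinates K J k"
  shows "NY_compact K"
proof (rule NY_compactI[OF K])
  let ?o = "\<lambda>j\<in>J. \<lambda>n::nat. 0::real"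
  show "compact_space hilbert_cube \<and> metrizable_space hilbert_cube"
    using compact_hilbert_cube metrizable_hilbert_cube by blast
  show "?o \<in> topspace (product_topology (\<lambda>_. hilbert_cube) J)"
    by (auto simp: hilbert_cube_def PiE_UNIV_domain)
  show "embedding_map K (subtopology (product_topology (\<lambda>_. hilbert_cube) J)
          (sigma_product (\<lambda>_. hilbert_cube) J ?o)) (\<lambda>x. restrict (k x) J)"
    using sigma_coordinates_embedding[OF K(1) k] by (simp add: embedding_map_in_subtopology)
qed

lemma NY_Valdivia_if_sigma_coordinates:
  assumes K: "compact_space K" "Hausdorff_space K" and k: "sigma_coordinates K J k"
  shows "NY_Valdivia K"
proof (rule NY_ValdiviaI[OF K sigma_coordinates_embedding(1)[OF K(1) k]])
  let ?k = "\<lambda>x. restrict (k x) J"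
  let ?P = "product_topology (\<lambda>_. hilbert_cube) J"
  have "?k ` topspace K \<inter> sigma_product (\<lambda>_. hilbert_cube) J (\<lambda>j\<in>J. \<lambda>n. 0) = ?k ` topspace K"
    using sigma_coordinates_embedding(2)[OF K(1) k] by blast
  moreover have "?k ` topspace K \<subseteq> topspace ?P"
    using sigma_coordinates_embedding(2)[OF K(1) k] by (auto simp: sigma_product_def)
  then have "topspace (subtopology ?P (?k ` topspace K)) = ?k ` topspace K"
    by (simp add: topspace_subtopology Int_absorb1)
  ultimately show "subtopology ?P (?k ` topspace K) closure_of
      (?k ` topspace K \<inter> sigma_product (\<lambda>_. hilbert_cube) J (\<lambda>j\<in>J. \<lambda>n. 0)) = ?k ` topspace K"
    by (metis closure_of_topspace)
qed

text \<open>
  The origin is a corner of the cube, so an embedding cannot simply be translated to send \<open>a\<close> there.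
  Recording the positive and the negative part of each coordinate of \<open>f x - f a\<close> separately keeps
  the values nonnegative and loses nothing.
\<close>

lemma pointed_embedding_hilbert_cube:
  assumes "compact_space X" "metrizable_space X" "a \<in> topspace X"
  obtains e where "continuous_map X hilbert_cube e" "inj_on e (topspace X)" "e a = (\<lambda>n. 0)"
proof -
  obtain f where "embedding_map X hilbert_cube f"
    using compact_metrizable_embeds_hilbert_cube[OF assms(1,2)] by blast
  then have f: "continuous_map X hilbert_cube f" "inj_on f (topspace X)"
    by (auto simp: embedding_map_def homeomorphic_eq_everything_map
        dest: continuous_map_into_fulltopology)
  have fc: "continuous_map X euclideanreal (\<lambda>x. f x n)" for n
    using f(1) by (auto simp: continuous_map_hilbert_cube_iff unit_map_iff)
  have fb: "0 \<le> f x n \<and> f x n \<le> 1" if "x \<in> topspace X" for x n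
    using f(1) that by (auto simp: continuous_map_hilbert_cube_iff unit_map_iff)
  define e where "e x n = (if even n then max 0 (f x (n div 2) - f a (n div 2))
      else max 0 (f a (n div 2) - f x (n div 2)))" for x n
  show thesis
  proof
    have "unit_map X (\<lambda>x. e x n)" for n
    proof -
      have "unit_map X (\<lambda>x. max 0 (f x m - f a m))" "unit_map X (\<lambda>x. max 0 (f a m - f x m))" for m
        using fc[of m] fb[of _ m] fb[OF assms(3), of m]
        by (auto intro!: unit_map_pos_part continuous_map_diff simp: algebra_simps add_increasing2)
      then show ?thesis by (cases "even n") (simp_all add: e_def)
    qed
    then show "continuous_map X hilbert_cube e" by (simp add: continuous_map_hilbert_cube_iff)
    show "inj_on e (topspace X)"
    proof (rule inj_onI)
      fix x y assume xy: "x \<in> topspace X" "y \<in> topspace X" "e x = e y"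
      have "f x n = f y n" for n
        using fun_cong[OF xy(3), of "2 * n"] fun_cong[OF xy(3), of "Suc (2 * n)"]
        by (simp add: e_def max_def split: if_splits)
      then show "x = y" using f(2) xy by (metis ext inj_onD)
    qed
    show "e a = (\<lambda>n. 0)" by (simp add: e_def fun_eq_iff)
  qed
qed

lemma NY_compact_imp_sigma_coordinates:
  fixes K :: "'a topology"
  assumes "NY_compact K"
  obtains J :: "('a \<times> 'a) set" and k where "sigma_coordinates K J k"
proof -
  obtain \<Gamma> :: "('a \<times> 'a) set" and X :: "'a \<times> 'a \<Rightarrow> (nat \<Rightarrow> real) topology" and a h where
    X: "\<forall>\<gamma>\<in>\<Gamma>. compact_space (X \<gamma>) \<and> metrizable_space (X \<gamma>)"
    and a: "a \<in> topspace (product_topology X \<Gamma>)"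
    and h: "embedding_map K (subtopology (product_topology X \<Gamma>) (sigma_product X \<Gamma> a)) h"
    using assms unfolding NY_compact_def by blast
  have hc: "continuous_map K (subtopology (product_topology X \<Gamma>) (sigma_product X \<Gamma> a)) h"
    and hi: "inj_on h (topspace K)"
    using h unfolding embedding_map_def homeomorphic_eq_everything_map
    by (auto dest: continuous_map_into_fulltopology)
  have hp: "continuous_map K (product_topology X \<Gamma>) h"
    and hs: "\<And>x. x \<in> topspace K \<Longrightarrow> h x \<in> sigma_product X \<Gamma> a"
    using hc by (auto simp: continuous_map_in_subtopology)
  have ht: "h x \<in> (\<Pi>\<^sub>E \<gamma>\<in>\<Gamma>. topspace (X \<gamma>))" if "x \<in> topspace K" for x
    using hs[OF that] by (simp add: sigma_product_def)
  have "\<forall>\<gamma>\<in>\<Gamma>. \<exists>e. continuous_map (X \<gamma>) hilbert_cube e \<and> inj_on e (topspace (X \<gamma>)) \<and> e (a \<gamma>) = (\<lambda>n. 0)"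
  proof
    fix \<gamma> assume g: "\<gamma> \<in> \<Gamma>"
    then have "a \<gamma> \<in> topspace (X \<gamma>)" using a by (auto simp: PiE_iff)
    then show "\<exists>e. continuous_map (X \<gamma>) hilbert_cube e \<and> inj_on e (topspace (X \<gamma>)) \<and> e (a \<gamma>) = (\<lambda>n. 0)"
      using X g pointed_embedding_hilbert_cube[of "X \<gamma>" "a \<gamma>"] by metis
  qed
  then obtain e where e: "\<And>\<gamma>. \<gamma> \<in> \<Gamma> \<Longrightarrow> continuous_map (X \<gamma>) hilbert_cube (e \<gamma>)"
      "\<And>\<gamma>. \<gamma> \<in> \<Gamma> \<Longrightarrow> inj_on (e \<gamma>) (topspace (X \<gamma>))" "\<And>\<gamma>. \<gamma> \<in> \<Gamma> \<Longrightarrow> e \<gamma> (a \<gamma>) = (\<lambda>n. 0)"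
    by metis
  have "sigma_coordinates K \<Gamma> (\<lambda>x \<gamma>. e \<gamma> (h x \<gamma>))"
    unfolding sigma_coordinates_def
  proof (intro conjI ballI impI)
    fix \<gamma> assume g: "\<gamma> \<in> \<Gamma>"
    then have "continuous_map K (X \<gamma>) (\<lambda>x. h x \<gamma>)"
      using hp by (simp add: continuous_map_componentwise)
    then show "continuous_map K hilbert_cube (\<lambda>x. e \<gamma> (h x \<gamma>))"
      using continuous_map_compose[OF _ e(1)[OF g]] by (simp add: o_def)
  next
    fix x assume "x \<in> topspace K"
    then have "finite {\<gamma> \<in> \<Gamma>. h x \<gamma> \<noteq> a \<gamma>}" using hs by (simp add: sigma_product_def)
    then show "finite {\<gamma> \<in> \<Gamma>. e \<gamma> (h x \<gamma>) \<noteq> (\<lambda>n. 0)}"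
      by (rule rev_finite_subset) (use e(3) in auto)
  next
    fix x y assume xy: "x \<in> topspace K" "y \<in> topspace K" "x \<noteq> y"
    then have "h x \<noteq> h y" using hi by (meson inj_onD)
    then obtain \<gamma> where "\<gamma> \<in> \<Gamma>" "h x \<gamma> \<noteq> h y \<gamma>"
      using ht[OF xy(1)] ht[OF xy(2)] by (meson PiE_ext)
    then show "\<exists>\<gamma>\<in>\<Gamma>. e \<gamma> (h x \<gamma>) \<noteq> e \<gamma> (h y \<gamma>)"
      using ht[OF xy(1)] ht[OF xy(2)] e(2) by (meson PiE_mem inj_onD)
  qed
  then show thesis by (rule that)
qed

section \<open>Topology of the Alexandroff duplicate\<close>

lemma openin_AD_isolated:
  "x \<in> topspace K \<Longrightarrow> openin (alexandroff_duplicate K) {(x, True)}"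
  by (auto simp: openin_alexandroff_duplicate)

lemma closedin_AD_isolated:
  assumes "Hausdorff_space K" "x \<in> topspace K"
  shows "closedin (alexandroff_duplicate K) {(x, True)}"
  unfolding closedin_def openin_alexandroff_duplicate
proof (intro conjI allI impI)
  fix y assume y: "(y, False) \<in> topspace (alexandroff_duplicate K) - {(x, True)}"
  have o: "openin K (topspace K - {x})"
    using assms by (simp add: openin_diff closedin_Hausdorff_sing_eq)
  show "\<exists>U. openin K U \<and> y \<in> U \<and>
      U \<times> UNIV - {(y, True)} \<subseteq> topspace (alexandroff_duplicate K) - {(x, True)}"
  proof (cases "y = x")
    case True
    then show ?thesis using y by (intro exI[of _ "topspace K"]) auto
  next
    case False
    then show ?thesis using y o by (intro exI[of _ "topspace K - {x}"]) auto
  qed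
qed (use assms in auto)

lemma continuous_map_AD_fst: "continuous_map (alexandroff_duplicate K) K fst"
  unfolding continuous_map_def
proof (intro conjI allI impI)
  fix U assume U: "openin K U"
  then have "{z \<in> topspace (alexandroff_duplicate K). fst z \<in> U} = U \<times> UNIV"
    using openin_subset by fastforce
  then show "openin (alexandroff_duplicate K) {z \<in> topspace (alexandroff_duplicate K). fst z \<in> U}"
    using U openin_subset by (fastforce simp: openin_alexandroff_duplicate)
qed auto

lemma continuous_map_into_AD: "continuous_map K (alexandroff_duplicate K) (\<lambda>x. (x, False))"
  unfolding continuous_map_def
proof (intro conjI allI impI)
  fix W assume W: "openin (alexandroff_duplicate K) W"
  show "openin K {x \<in> topspace K. (x, False) \<in> W}"
  proof (subst openin_subopen, intro ballI)
    fix x assume x: "x \<in> {x \<in> topspace K. (x, False) \<in> W}"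
    then obtain U where U: "openin K U" "x \<in> U" "U \<times> UNIV - {(x, True)} \<subseteq> W"
      using W unfolding openin_alexandroff_duplicate by blast
    then show "\<exists>T. openin K T \<and> x \<in> T \<and> T \<subseteq> {x \<in> topspace K. (x, False) \<in> W}"
      using openin_subset by (intro exI[of _ U]) blast
  qed
qed auto

text \<open>
  A basic neighborhood of \<open>(x,0)\<close> omits just one point of \<open>U \<times> {0,1}\<close>, so a finite cover of the
  compact set \<open>L\<close> by such neighborhoods inside \<open>V\<close> misses only the finitely many twins of its centers.
\<close>

lemma finite_exceptions_AD:
  assumes K: "compact_space K" and V: "openin (alexandroff_duplicate K) V"
    and L: "closedin K L" "\<And>x. x \<in> L \<Longrightarrow> (x, False) \<in> V"
  shows "finite {x \<in> L. (x, True) \<notin> V}"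
proof -
  have "\<forall>x\<in>L. \<exists>U. openin K U \<and> x \<in> U \<and> U \<times> UNIV - {(x, True)} \<subseteq> V"
    using V L(2) unfolding openin_alexandroff_duplicate by blast
  then obtain U where U: "\<And>x. x \<in> L \<Longrightarrow> openin K (U x) \<and> x \<in> U x \<and> U x \<times> UNIV - {(x, True)} \<subseteq> V"
    by metis
  have "compactin K L" using K L(1) closedin_compact_space by blast
  moreover have "openin K W" if "W \<in> U ` L" for W using that U by auto
  moreover have "L \<subseteq> \<Union>(U ` L)" using U by auto
  ultimately obtain \<F> where F: "finite \<F>" "\<F> \<subseteq> U ` L" "L \<subseteq> \<Union>\<F>"
    using compactinD[of K L "U ` L"] by metis
  obtain S where S: "finite S" "S \<subseteq> L" "\<F> = U ` S"
    using finite_subset_image[OF F(1,2)] by blast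
  have "{x \<in> L. (x, True) \<notin> V} \<subseteq> S"
  proof clarify
    fix x assume x: "x \<in> L" "(x, True) \<notin> V"
    then obtain s where s: "s \<in> S" "x \<in> U s" using F(3) S(3) by blast
    then have "U s \<times> UNIV - {(s, True)} \<subseteq> V" using U S(2) by blast
    then have "x = s" using x(2) s(2) by blast
    then show "x \<in> S" using s(1) by simp
  qed
  then show ?thesis using S(1) finite_subset by blast
qed

lemma compact_space_AD:
  assumes K: "compact_space K"
  shows "compact_space (alexandroff_duplicate K)"
  unfolding compact_space_def compactin_def
proof (intro conjI allI impI)
  fix \<U> assume a: "Ball \<U> (openin (alexandroff_duplicate K)) \<and> topspace (alexandroff_duplicate K) \<subseteq> \<Union>\<U>"
  let ?V = "\<lambda>W. {x \<in> topspace K. (x, False) \<in> W}"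
  have "openin K (?V W)" if "W \<in> \<U>" for W
    using continuous_map_into_AD a that openin_continuous_map_preimage by blast
  then have "openin K T" if "T \<in> ?V ` \<U>" for T using that by auto
  moreover have "topspace K \<subseteq> \<Union>(?V ` \<U>)"
  proof
    fix x assume "x \<in> topspace K"
    then have "(x, False) \<in> \<Union>\<U>" using a by (metis UNIV_I mem_Sigma_iff subsetD topspace_alexandroff_duplicate)
    then show "x \<in> \<Union>(?V ` \<U>)" using \<open>x \<in> topspace K\<close> by blast
  qed
  moreover have "compactin K (topspace K)" using K by (simp add: compact_space_def)
  ultimately have "\<exists>\<G>. finite \<G> \<and> \<G> \<subseteq> ?V ` \<U> \<and> topspace K \<subseteq> \<Union>\<G>"
    by (intro compactinD)
  then obtain \<G> where G: "finite \<G>" "\<G> \<subseteq> ?V ` \<U>" "topspace K \<subseteq> \<Union>\<G>" by blast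
  obtain \<F> where F: "finite \<F>" "\<F> \<subseteq> \<U>" "\<G> = ?V ` \<F>"
    using finite_subset_image[OF G(1,2)] by blast
  have cov: "(x, False) \<in> \<Union>\<F>" if "x \<in> topspace K" for x
    using G(3) that unfolding F(3) by blast
  have "openin (alexandroff_duplicate K) (\<Union>\<F>)"
    by (rule openin_Union) (use a F(2) in blast)
  then have "finite {x \<in> topspace K. (x, True) \<notin> \<Union>\<F>}"
    by (rule finite_exceptions_AD[OF K]) (use cov in auto)
  then have R: "finite (topspace (alexandroff_duplicate K) - \<Union>\<F>)"
  proof (rule finite_surj)
    show "topspace (alexandroff_duplicate K) - \<Union>\<F>
        \<subseteq> (\<lambda>x. (x, True)) ` {x \<in> topspace K. (x, True) \<notin> \<Union>\<F>}"
    proof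
      fix z assume z: "z \<in> topspace (alexandroff_duplicate K) - \<Union>\<F>"
      obtain x b where zx: "z = (x, b)" by fastforce
      then have "b" using cov[of x] z by (cases b) auto
      then show "z \<in> (\<lambda>x. (x, True)) ` {x \<in> topspace K. (x, True) \<notin> \<Union>\<F>}"
        using z zx by auto
    qed
  qed
  have "\<forall>z\<in>topspace (alexandroff_duplicate K) - \<Union>\<F>. \<exists>W\<in>\<U>. z \<in> W" using a by blast
  then obtain c where c: "\<And>z. z \<in> topspace (alexandroff_duplicate K) - \<Union>\<F> \<Longrightarrow> c z \<in> \<U> \<and> z \<in> c z"
    by metis
  show "\<exists>\<F>. finite \<F> \<and> \<F> \<subseteq> \<U> \<and> topspace (alexandroff_duplicate K) \<subseteq> \<Union>\<F>"
  proof (intro exI conjI)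
    let ?R = "topspace (alexandroff_duplicate K) - \<Union>\<F>"
    show "finite (\<F> \<union> c ` ?R)" using F(1) R by blast
    show "\<F> \<union> c ` ?R \<subseteq> \<U>" using F(2) c by blast
    show "topspace (alexandroff_duplicate K) \<subseteq> \<Union>(\<F> \<union> c ` ?R)"
    proof
      fix z assume z: "z \<in> topspace (alexandroff_duplicate K)"
      show "z \<in> \<Union>(\<F> \<union> c ` ?R)"
      proof (cases "z \<in> \<Union>\<F>")
        case False
        then show ?thesis using z c[of z] by blast
      qed simp
    qed
  qed
qed simp

lemma Hausdorff_space_AD:
  assumes "Hausdorff_space K"
  shows "Hausdorff_space (alexandroff_duplicate K)"
  unfolding Hausdorff_space_def
proof (intro allI impI)
  let ?A = "alexandroff_duplicate K"
  fix z w assume zw: "z \<in> topspace ?A \<and> w \<in> topspace ?A \<and> z \<noteq> w"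
  show "\<exists>U V. openin ?A U \<and> openin ?A V \<and> z \<in> U \<and> w \<in> V \<and> disjnt U V"
  proof (cases "fst z = fst w")
    case False
    then obtain U V where UV: "openin K U" "openin K V" "fst z \<in> U" "fst w \<in> V" "disjnt U V"
      using assms zw unfolding Hausdorff_space_def by (metis SigmaE fst_conv topspace_alexandroff_duplicate)
    have "openin ?A {q \<in> topspace ?A. fst q \<in> U}" "openin ?A {q \<in> topspace ?A. fst q \<in> V}"
      using UV openin_continuous_map_preimage[OF continuous_map_AD_fst] by blast+
    then show ?thesis using UV zw
      by (intro exI[of _ "{q \<in> topspace ?A. fst q \<in> U}"] exI[of _ "{q \<in> topspace ?A. fst q \<in> V}"])
        (auto simp: disjnt_iff)
  next
    case True
    define x where "x = fst z"
    have x: "x \<in> topspace K" using zw by (auto simp: x_def)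
    have o: "openin ?A {(x, True)}" "openin ?A (topspace ?A - {(x, True)})"
      using openin_AD_isolated[OF x] closedin_AD_isolated[OF assms x]
      by (auto simp: closedin_def)
    have "z = (x, True) \<and> w = (x, False) \<or> z = (x, False) \<and> w = (x, True)"
      using True zw by (cases z; cases w) (auto simp: x_def)
    then show ?thesis
      using o zw
      by (elim disjE; intro exI[of _ "{(x, True)}"] exI[of _ "topspace ?A - {(x, True)}"])
        (auto simp: disjnt_iff intro: exI[of _ "{(x, True)}"])
  qed
qed

section \<open>From the space to its duplicate\<close>

lemma unit_map_clopen_indicator:
  assumes "openin X S" "closedin X S"
  shows "unit_map X (\<lambda>z. if z \<in> S then 1 else 0)"
proof -
  have "openin X {z \<in> topspace X. (if z \<in> S then 1 else 0) \<in> U}" for U :: "real set"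
  proof -
    have "{z \<in> topspace X. (if z \<in> S then 1 else 0) \<in> U} =
        (if 1 \<in> U then S else {}) \<union> (if 0 \<in> U then topspace X - S else {})"
      using openin_subset[OF assms(1)] by auto
    then show ?thesis using assms by auto
  qed
  then show ?thesis by (auto simp: unit_map_iff continuous_map_def)
qed

text \<open>
  The coordinates of \<open>K\<close> separate points with different first component; the indicator of \<open>(x,1)\<close>
  separates \<open>(x,0)\<close> from \<open>(x,1)\<close>, and at each point at most one indicator is nonzero.
\<close>

lemma NY_compact_AD:
  fixes K :: "'a topology"
  assumes K: "compact_space K" "Hausdorff_space K" and NY: "NY_compact K"
  shows "NY_compact (alexandroff_duplicate K)"
proof -
  let ?A = "alexandroff_duplicate K"
  obtain J :: "('a \<times> 'a) set" and k where k: "sigma_coordinates K J k"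
    using NY_compact_imp_sigma_coordinates[OF NY] .
  define l where "l z j = (case j of Inl i \<Rightarrow> k (fst z) i
      | Inr x \<Rightarrow> (\<lambda>n::nat. if z \<in> {(x, True)} then 1 else (0::real)))" for z :: "'a \<times> bool" and j
  have "sigma_coordinates ?A (J <+> topspace K) l"
    unfolding sigma_coordinates_def
  proof (intro conjI ballI impI)
    fix j assume "j \<in> J <+> topspace K"
    then show "continuous_map ?A hilbert_cube (\<lambda>z. l z j)"
    proof
      fix i assume i: "i \<in> J" "j = Inl i"
      then have "continuous_map K hilbert_cube (\<lambda>x. k x i)"
        using k by (simp add: sigma_coordinates_def)
      then show ?thesis
        using i continuous_map_compose[OF continuous_map_AD_fst] by (fastforce simp: l_def o_def)
    next
      fix x assume x: "x \<in> topspace K" "j = Inr x"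
      then show ?thesis
        using unit_map_clopen_indicator[OF openin_AD_isolated closedin_AD_isolated[OF K(2)]]
        by (simp add: l_def continuous_map_hilbert_cube_iff)
    qed
  next
    fix z assume z: "z \<in> topspace ?A"
    have "{j \<in> J <+> topspace K. l z j \<noteq> (\<lambda>n. 0)}
        \<subseteq> Inl ` {i \<in> J. k (fst z) i \<noteq> (\<lambda>n. 0)} \<union> {Inr (fst z)}"
      by (auto simp: l_def split: if_splits)
    moreover have "finite {i \<in> J. k (fst z) i \<noteq> (\<lambda>n. 0)}"
      using k z unfolding sigma_coordinates_def by auto
    ultimately show "finite {j \<in> J <+> topspace K. l z j \<noteq> (\<lambda>n. 0)}"
      by (meson finite.emptyI finite_UnI finite_imageI finite_insert finite_subset)
  next
    fix z w assume zw: "z \<in> topspace ?A" "w \<in> topspace ?A" "z \<noteq> w"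
    show "\<exists>j\<in>J <+> topspace K. l z j \<noteq> l w j"
    proof (cases "fst z = fst w")
      case False
      then obtain i where "i \<in> J" "k (fst z) i \<noteq> k (fst w) i"
        using k zw unfolding sigma_coordinates_def by (metis SigmaE fst_conv topspace_alexandroff_duplicate)
      then show ?thesis by (intro bexI[of _ "Inl i"]) (auto simp: l_def)
    next
      case True
      then have "l z (Inr (fst z)) \<noteq> l w (Inr (fst z))"
        using zw(3) by (cases z; cases w) (auto simp: l_def fun_eq_iff)
      then show ?thesis using zw(1) by (intro bexI[of _ "Inr (fst z)"]) auto
    qed
  qed
  then show ?thesis
    by (rule NY_compact_if_sigma_coordinates[OF compact_space_AD[OF K(1)] Hausdorff_space_AD[OF K(2)]])
qed

section \<open>From the duplicate back to the space\<close>

text \<open>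
  Finite supports on the copy of isolated points suffice. In the proof, \<open>v \<gamma>\<close> measures the size of
  \<open>h (x, False) \<gamma>\<close>, \<open>B\<close> is the set of bad points, \<open>D \<gamma>\<close> the set to be removed from
  the cozero set of \<open>v \<gamma>\<close>, \<open>G \<gamma> E\<close> a function whose cozero set is that of \<open>v \<gamma>\<close> without \<open>E\<close>,
  and \<open>N x\<close> the set of indices whose reduced coordinate is nonzero at \<open>x\<close>.
\<close>

lemma NY_compact_if_finite_support_on_isolated:
  fixes h :: "'a \<times> bool \<Rightarrow> 'i \<Rightarrow> nat \<Rightarrow> real"
  assumes K: "compact_space K" "Hausdorff_space K"
    and h: "\<And>\<gamma>. \<gamma> \<in> \<Gamma> \<Longrightarrow> continuous_map (alexandroff_duplicate K) hilbert_cube (\<lambda>z. h z \<gamma>)"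
    and sep: "\<And>x y. \<lbrakk>x \<in> topspace K; y \<in> topspace K; x \<noteq> y\<rbrakk>
        \<Longrightarrow> \<exists>\<gamma>\<in>\<Gamma>. h (x, False) \<gamma> \<noteq> h (y, False) \<gamma>"
    and fin: "\<And>x. x \<in> topspace K \<Longrightarrow> finite {\<gamma> \<in> \<Gamma>. h (x, True) \<gamma> \<noteq> (\<lambda>n. 0)}"
  shows "NY_compact K"
proof -
  let ?A = "alexandroff_duplicate K"
  have "\<exists>u. unit_map ?A u \<and> (\<forall>z\<in>topspace ?A. u z = 0 \<longleftrightarrow> h z \<gamma> = (\<lambda>n. 0))" if "\<gamma> \<in> \<Gamma>" for \<gamma>
  proof -
    have "unit_map ?A (\<lambda>z. h z \<gamma> n)" for n
      using h[OF that] by (simp add: continuous_map_hilbert_cube_iff)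
    then show ?thesis
      using common_zero_function[of ?A "\<lambda>n z. h z \<gamma> n"] by (simp add: fun_eq_iff)
  qed
  then obtain u where u: "\<And>\<gamma>. \<gamma> \<in> \<Gamma> \<Longrightarrow> unit_map ?A (u \<gamma>)"
      "\<And>\<gamma> z. \<gamma> \<in> \<Gamma> \<Longrightarrow> z \<in> topspace ?A \<Longrightarrow> u \<gamma> z = 0 \<longleftrightarrow> h z \<gamma> = (\<lambda>n. 0)"
    by metis
  define v where "v = (\<lambda>\<gamma> x. u \<gamma> (x, False))"
  have v: "unit_map K (v \<gamma>)" if "\<gamma> \<in> \<Gamma>" for \<gamma>
    using continuous_map_compose[OF continuous_map_into_AD u(1)[OF that]]
    by (simp add: v_def o_def)
  have v0: "v \<gamma> x = 0 \<longleftrightarrow> h (x, False) \<gamma> = (\<lambda>n. 0)" if "\<gamma> \<in> \<Gamma>" "x \<in> topspace K" for \<gamma> x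
    using u(2)[OF that(1)] that(2) by (simp add: v_def)
  have vge: "0 \<le> v \<gamma> x" "v \<gamma> x \<le> 1" if "\<gamma> \<in> \<Gamma>" "x \<in> topspace K" for \<gamma> x
    using v[OF that(1)] that(2) by (auto simp: unit_map_iff)
  have upos: "openin ?A {z \<in> topspace ?A. u \<gamma> z \<noteq> 0}" if "\<gamma> \<in> \<Gamma>" for \<gamma>
  proof -
    have "continuous_map ?A euclideanreal (u \<gamma>)" using u(1)[OF that] by (simp add: unit_map_iff)
    then have "openin ?A {z \<in> topspace ?A. u \<gamma> z \<in> - {0}}"
      by (rule openin_continuous_map_preimage) (simp add: open_Compl)
    then show ?thesis by simp
  qed
  have finT: "finite {\<gamma> \<in> \<Gamma>. u \<gamma> (x, True) \<noteq> 0}" if "x \<in> topspace K" for x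
    using fin[OF that] by (rule rev_finite_subset) (use u(2) that in auto)

  define B where "B = {x \<in> topspace K. infinite {\<gamma> \<in> \<Gamma>. v \<gamma> x \<noteq> 0}}"
  define D where "D \<gamma> = {y \<in> B. v \<gamma> y \<noteq> 0 \<and> u \<gamma> (y, True) = 0}" for \<gamma>
  have BK: "B \<subseteq> topspace K" by (auto simp: B_def)
  have DB: "D \<gamma> \<subseteq> B" for \<gamma> by (auto simp: D_def)
  \<comment> \<open>The twins of these points lie outside the open set where \<open>u \<gamma>\<close> is nonzero.\<close>
  have Dfin: "finite {y \<in> D \<gamma>. \<epsilon> \<le> v \<gamma> y}" if "\<gamma> \<in> \<Gamma>" "\<epsilon> > 0" for \<gamma> \<epsilon>
  proof -
    have "continuous_map K euclideanreal (v \<gamma>)" using v[OF that(1)] by (simp add: unit_map_iff)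
    then have "closedin K {x \<in> topspace K. v \<gamma> x \<in> {\<epsilon>..}}"
      by (rule closedin_continuous_map_preimage) simp
    then have "finite {x \<in> {x \<in> topspace K. v \<gamma> x \<in> {\<epsilon>..}}. (x, True) \<notin> {z \<in> topspace ?A. u \<gamma> z \<noteq> 0}}"
      by (rule finite_exceptions_AD[OF K(1) upos[OF that(1)]]) (use that(2) in \<open>auto simp: v_def\<close>)
    then show ?thesis
      by (rule rev_finite_subset) (use BK in \<open>auto simp: D_def\<close>)
  qed
  \<comment> \<open>Every bad point is a \<open>G\<^sub>\<delta>\<close> point.\<close>
  have "\<exists>\<theta>. unit_map K \<theta> \<and> (\<forall>x\<in>topspace K. \<theta> x = 0 \<longleftrightarrow> x = y)" if y: "y \<in> B" for y
  proof -
    have "infinite {\<gamma> \<in> \<Gamma>. v \<gamma> y \<noteq> 0}" using y by (simp add: B_def)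
    then obtain s :: "nat \<Rightarrow> 'i" where s: "inj s" "range s \<subseteq> {\<gamma> \<in> \<Gamma>. v \<gamma> y \<noteq> 0}"
      using infinite_countable_subset by blast
    have "\<exists>U. openin K U \<and> y \<in> U \<and> U \<times> UNIV - {(y, True)} \<subseteq> {z \<in> topspace ?A. u (s n) z \<noteq> 0}" for n
    proof -
      have "(y, False) \<in> {z \<in> topspace ?A. u (s n) z \<noteq> 0}" "s n \<in> \<Gamma>"
        using s(2) y BK by (auto simp: v_def)
      moreover from this have "openin ?A {z \<in> topspace ?A. u (s n) z \<noteq> 0}" using upos by blast
      ultimately show ?thesis unfolding openin_alexandroff_duplicate by meson
    qed
    then have "\<exists>U. \<forall>n. openin K (U n) \<and> y \<in> U n \<and>
        U n \<times> UNIV - {(y, True)} \<subseteq> {z \<in> topspace ?A. u (s n) z \<noteq> 0}"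
      by (intro choice allI)
    then obtain U where U: "\<And>n. openin K (U n)" "\<And>n. y \<in> U n"
        "\<And>n. U n \<times> UNIV - {(y, True)} \<subseteq> {z \<in> topspace ?A. u (s n) z \<noteq> 0}"
      by blast
    have "x = y" if x: "\<forall>n. x \<in> U n" for x
    proof (rule ccontr)
      assume "x \<noteq> y"
      then have "u (s n) (x, True) \<noteq> 0" for n using U(3)[of n] x by blast
      then have "range s \<subseteq> {\<gamma> \<in> \<Gamma>. u \<gamma> (x, True) \<noteq> 0}" using s(2) by auto
      moreover have "x \<in> topspace K" using x U(1) openin_subset by blast
      ultimately have "finite (range s)" using finT finite_subset by blast
      then show False using s(1) finite_imageD by blast
    qed
    then have "(\<Inter>n. U n) \<subseteq> {y}" by blast
    moreover have "y \<in> topspace K" using y BK by blast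
    ultimately show ?thesis
      using Gdelta_point_zero_function[OF K _ U(1,2)] by simp
  qed
  then obtain \<theta> where \<theta>: "\<And>y. y \<in> B \<Longrightarrow> unit_map K (\<theta> y)"
      "\<And>y x. y \<in> B \<Longrightarrow> x \<in> topspace K \<Longrightarrow> \<theta> y x = 0 \<longleftrightarrow> x = y"
    by metis
  have "\<exists>g. unit_map K g \<and> (\<forall>x\<in>topspace K. g x = 0 \<longleftrightarrow> v \<gamma> x = 0 \<or> x \<in> E)"
    if g: "\<gamma> \<in> \<Gamma>" and E: "E \<subseteq> D \<gamma>" for \<gamma> E
  proof (rule zero_function_with_extra_zeros[OF v[OF g]])
    show "finite {y \<in> E. \<epsilon> \<le> v \<gamma> y}" if "\<epsilon> > 0" for \<epsilon>
      using Dfin[OF g that] by (rule rev_finite_subset) (use E in auto)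
    show "unit_map K (\<theta> y)" if "y \<in> E" for y
      using \<theta>(1) that E DB by blast
    show "\<theta> y x = 0 \<longleftrightarrow> x = y" if "y \<in> E" "x \<in> topspace K" for y x
      using \<theta>(2) that E DB by blast
  qed
  then obtain G where G: "\<And>\<gamma> E. \<gamma> \<in> \<Gamma> \<Longrightarrow> E \<subseteq> D \<gamma> \<Longrightarrow> unit_map K (G \<gamma> E)"
      "\<And>\<gamma> E x. \<gamma> \<in> \<Gamma> \<Longrightarrow> E \<subseteq> D \<gamma> \<Longrightarrow> x \<in> topspace K \<Longrightarrow> G \<gamma> E x = 0 \<longleftrightarrow> v \<gamma> x = 0 \<or> x \<in> E"
    by metis
  \<comment> \<open>\<open>(y, False)\<close> has infinite support, and \<open>(y, True)\<close> finite support.\<close>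
  have "\<exists>\<gamma>\<in>\<Gamma>. y \<in> D \<gamma>" if y: "y \<in> B" for y
  proof -
    have "infinite ({\<gamma> \<in> \<Gamma>. v \<gamma> y \<noteq> 0} - {\<gamma> \<in> \<Gamma>. u \<gamma> (y, True) \<noteq> 0})"
      using y finT BK by (intro Diff_infinite_finite) (auto simp: B_def)
    then have "{\<gamma> \<in> \<Gamma>. v \<gamma> y \<noteq> 0} - {\<gamma> \<in> \<Gamma>. u \<gamma> (y, True) \<noteq> 0} \<noteq> {}" by force
    then show ?thesis using y by (auto simp: D_def)
  qed
  then obtain c where c: "\<And>y. y \<in> B \<Longrightarrow> c y \<in> \<Gamma>" "\<And>y. y \<in> B \<Longrightarrow> y \<in> D (c y)" by metis

  \<comment> \<open>The second factor is nonzero at \<open>x\<close> only if \<open>v (c y) y > v (c y) x / 2\<close>. Among the \<open>y\<close> that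
    share a value \<open>\<gamma>\<close> of \<open>c\<close> this leaves finitely many, as long as \<open>v \<gamma> x > 0\<close>.\<close>
  define \<psi> where "\<psi> y x = G (c y) (D (c y) - {y}) x * max 0 (v (c y) y - v (c y) x / 2)" for y x
  \<comment> \<open>Coordinate \<open>0\<close> holds the cut-off factor itself, so that dividing by it recovers
    \<open>h (x, False) \<gamma>\<close> wherever it is nonzero.\<close>
  define k where "k x j = (case j of
      Inl \<gamma> \<Rightarrow> (\<lambda>n. G \<gamma> (D \<gamma>) x * (case n of 0 \<Rightarrow> 1 | Suc m \<Rightarrow> h (x, False) \<gamma> m))
    | Inr y \<Rightarrow> (\<lambda>n. \<psi> y x))" for x j
  have k_Inl: "k x (Inl \<gamma>) = (\<lambda>n. G \<gamma> (D \<gamma>) x * (case n of 0 \<Rightarrow> 1 | Suc m \<Rightarrow> h (x, False) \<gamma> m))"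
    and k_Inr: "k x (Inr y) = (\<lambda>n. \<psi> y x)" for x \<gamma> y
    by (simp_all add: k_def)
  define N where "N x = {\<gamma> \<in> \<Gamma>. v \<gamma> x \<noteq> 0 \<and> x \<notin> D \<gamma>}" for x
  have N: "finite (N x)" if x: "x \<in> topspace K" for x
  proof (cases "x \<in> B")
    case True
    \<comment> \<open>A bad \<open>x\<close> outside \<open>D \<gamma>\<close> with \<open>v \<gamma> x \<noteq> 0\<close> has \<open>\<gamma>\<close> in the support of its twin.\<close>
    then have "N x \<subseteq> {\<gamma> \<in> \<Gamma>. u \<gamma> (x, True) \<noteq> 0}" by (auto simp: N_def D_def)
    then show ?thesis using finT[OF x] finite_subset by blast
  next
    case False
    then have "finite {\<gamma> \<in> \<Gamma>. v \<gamma> x \<noteq> 0}" using x by (simp add: B_def)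
    then show ?thesis by (rule rev_finite_subset) (auto simp: N_def)
  qed
  have GN: "G \<gamma> (D \<gamma>) x \<noteq> 0 \<longleftrightarrow> \<gamma> \<in> N x" if "\<gamma> \<in> \<Gamma>" "x \<in> topspace K" for \<gamma> x
    using G(2)[OF that(1) subset_refl that(2)] that(1) by (auto simp: N_def)
  have \<psi>pos: "\<psi> y y \<noteq> 0" if y: "y \<in> B" for y
  proof -
    have "v (c y) y \<noteq> 0" using c(2)[OF y] by (simp add: D_def)
    then have "v (c y) y > 0" using vge(1)[OF c(1)[OF y], of y] y BK by force
    then show ?thesis
      using G(2)[OF c(1)[OF y], of "D (c y) - {y}" y] y BK by (auto simp: \<psi>_def max_def)
  qed
  have \<psi>N: "c y \<in> N x \<and> v (c y) x / 2 \<le> v (c y) y"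
    if y: "y \<in> B" and x: "x \<in> topspace K" "x \<noteq> y" and nz: "\<psi> y x \<noteq> 0" for x y
  proof -
    have "G (c y) (D (c y) - {y}) x \<noteq> 0" using nz by (auto simp: \<psi>_def)
    then have "c y \<in> N x" using G(2)[OF c(1)[OF y], of "D (c y) - {y}" x] x c(1)[OF y]
      by (auto simp: N_def)
    then show ?thesis using nz by (auto simp: \<psi>_def max_def split: if_splits)
  qed

  have coord_c: "continuous_map K hilbert_cube (\<lambda>x. k x j)" if "j \<in> \<Gamma> <+> B" for j
    using that
  proof
    fix \<gamma> assume g: "\<gamma> \<in> \<Gamma>" and j: "j = Inl \<gamma>"
    have "unit_map K (\<lambda>x. case n of 0 \<Rightarrow> 1 | Suc m \<Rightarrow> h (x, False) \<gamma> m)" for n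
    proof (cases n)
      case (Suc m)
      have "unit_map ?A (\<lambda>z. h z \<gamma> m)"
        using h[OF g] by (simp add: continuous_map_hilbert_cube_iff)
      then show ?thesis
        using Suc continuous_map_compose[OF continuous_map_into_AD] by (fastforce simp: o_def)
    qed (simp add: unit_map_iff)
    then show ?thesis
      unfolding j k_Inl continuous_map_hilbert_cube_iff
      by (intro allI unit_map_mult G(1)[OF g subset_refl])
  next
    fix y assume y: "y \<in> B" and j: "j = Inr y"
    have "unit_map K (\<lambda>x. max 0 (v (c y) y - v (c y) x / 2))"
    proof (rule unit_map_pos_part)
      show "continuous_map K euclideanreal (\<lambda>x. v (c y) y - v (c y) x / 2)"
        using v[OF c(1)[OF y]]
        by (auto simp: unit_map_iff intro!: continuous_map_diff continuous_map_real_divide)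
      show "v (c y) y - v (c y) x / 2 \<le> 1" if "x \<in> topspace K" for x
        using vge(1)[OF c(1)[OF y] that] vge(2)[OF c(1)[OF y], of y] y BK by auto
    qed
    then show ?thesis
      unfolding j k_Inr continuous_map_hilbert_cube_iff \<psi>_def
      using c(1)[OF y] by (intro allI unit_map_mult G(1)) auto
  qed
  have coord_f: "finite {j \<in> \<Gamma> <+> B. k x j \<noteq> (\<lambda>n. 0)}" if x: "x \<in> topspace K" for x
  proof -
    have "v \<gamma> x / 2 > 0" "\<gamma> \<in> \<Gamma>" if "\<gamma> \<in> N x" for \<gamma>
      using that vge(1)[of \<gamma> x] x by (auto simp: N_def)
    then have "finite (\<Union>\<gamma>\<in>N x. {y \<in> D \<gamma>. v \<gamma> x / 2 \<le> v \<gamma> y})" (is "finite ?Y")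
      using N[OF x] Dfin by blast
    then have "finite (Inl ` N x \<union> Inr ` (insert x ?Y))" using N[OF x] by blast
    moreover have "{j \<in> \<Gamma> <+> B. k x j \<noteq> (\<lambda>n. 0)} \<subseteq> Inl ` N x \<union> Inr ` (insert x ?Y)"
    proof clarify
      fix j assume j: "j \<in> \<Gamma> <+> B" "k x j \<noteq> (\<lambda>n. 0)" "j \<notin> Inr ` (insert x ?Y)"
      show "j \<in> Inl ` N x"
        using j(1)
      proof
        fix \<gamma> assume "\<gamma> \<in> \<Gamma>" "j = Inl \<gamma>"
        moreover from this have "G \<gamma> (D \<gamma>) x \<noteq> 0" using j(2) by (auto simp: k_Inl)
        ultimately show ?thesis using GN x by blast
      next
        fix y assume y: "y \<in> B" "j = Inr y"
        then have "\<psi> y x \<noteq> 0" "x \<noteq> y" using j by (auto simp: k_Inr)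
        then have "y \<in> ?Y" using \<psi>N[OF y(1) x] c(2)[OF y(1)] by blast
        then show ?thesis using y j(3) by blast
      qed
    qed
    ultimately show ?thesis using finite_subset by blast
  qed
  \<comment> \<open>The reduced coordinate \<open>c y\<close> vanishes at \<open>y\<close>. Where it vanishes too, apart from \<open>y\<close>
    itself, \<open>\<psi> y\<close> is zero.\<close>
  have sepB: "\<exists>j\<in>\<Gamma> <+> B. k y j \<noteq> k z j" if y: "y \<in> B" and z: "z \<in> topspace K" "z \<noteq> y" for y z
  proof (cases "c y \<in> N z")
    case True
    have "G (c y) (D (c y)) z \<noteq> 0" "G (c y) (D (c y)) y = 0"
      using True GN[OF c(1)[OF y]] z(1) y BK c(2)[OF y] by (auto simp: N_def)
    then have "k y (Inl (c y)) 0 \<noteq> k z (Inl (c y)) 0" by (simp add: k_Inl)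
    then show ?thesis using c(1)[OF y] by (intro bexI[of _ "Inl (c y)"]) auto
  next
    case False
    then have "\<psi> y z = 0" using \<psi>N[OF y z] by blast
    then have "k y (Inr y) 0 \<noteq> k z (Inr y) 0" using \<psi>pos[OF y] by (simp add: k_Inr)
    then show ?thesis using y by (intro bexI[of _ "Inr y"]) auto
  qed
  have coord_s: "\<exists>j\<in>\<Gamma> <+> B. k y j \<noteq> k z j"
    if y: "y \<in> topspace K" and z: "z \<in> topspace K" and yz: "y \<noteq> z" for y z
  proof (cases "y \<in> B \<or> z \<in> B")
    case True
    then show ?thesis using sepB[of y z] sepB[of z y] y z yz by metis
  next
    case False
    obtain \<gamma> where g: "\<gamma> \<in> \<Gamma>" "h (y, False) \<gamma> \<noteq> h (z, False) \<gamma>" using sep[OF y z yz] by blast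
    then obtain m where m: "h (y, False) \<gamma> m \<noteq> h (z, False) \<gamma> m" by blast
    \<comment> \<open>Points outside \<open>B\<close> are in no \<open>D \<gamma>\<close>, so nothing was cut off there.\<close>
    have G0: "G \<gamma> (D \<gamma>) x = 0 \<longleftrightarrow> h (x, False) \<gamma> = (\<lambda>n. 0)" if "x \<in> {y, z}" for x
      using that False y z GN[OF g(1), of x] v0[OF g(1), of x] DB g(1) by (auto simp: N_def)
    have "k y (Inl \<gamma>) \<noteq> k z (Inl \<gamma>)"
    proof
      assume e: "k y (Inl \<gamma>) = k z (Inl \<gamma>)"
      have "G \<gamma> (D \<gamma>) y = G \<gamma> (D \<gamma>) z" using fun_cong[OF e, of 0] by (simp add: k_Inl)
      moreover have "G \<gamma> (D \<gamma>) y * h (y, False) \<gamma> m = G \<gamma> (D \<gamma>) z * h (z, False) \<gamma> m"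
        using fun_cong[OF e, of "Suc m"] by (simp add: k_Inl)
      ultimately show False using m G0[of y] G0[of z] by auto
    qed
    then show ?thesis using g(1) by (intro bexI[of _ "Inl \<gamma>"]) auto
  qed
  have "sigma_coordinates K (\<Gamma> <+> B) k"
    using coord_c coord_f coord_s unfolding sigma_coordinates_def by blast
  then show ?thesis by (rule NY_compact_if_sigma_coordinates[OF K])
qed

lemma isolated_point_in_dense_set:
  assumes "X closure_of S = topspace X" "openin X {p}"
  shows "p \<in> S"
proof -
  have "p \<in> X closure_of S" using assms openin_subset by blast
  then show ?thesis using assms(2) unfolding in_closure_of by blast
qed

text \<open>
  The points \<open>(x,1)\<close> are isolated, so their images belong to the dense part in the \<open>\<sigma>\<close>-product.
\<close>

lemma NY_compact_if_NY_Valdivia_AD: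
  fixes K :: "'a topology"
  assumes K: "compact_space K" "Hausdorff_space K" and V: "NY_Valdivia (alexandroff_duplicate K)"
  shows "NY_compact K"
proof -
  let ?A = "alexandroff_duplicate K"
  obtain \<Gamma> :: "(('a \<times> bool) \<times> ('a \<times> bool)) set" and h where
    h: "embedding_map ?A (product_topology (\<lambda>_. hilbert_cube) \<Gamma>) h"
    and dense: "(subtopology (product_topology (\<lambda>_. hilbert_cube) \<Gamma>) (h ` topspace ?A)) closure_of
          (h ` topspace ?A \<inter> sigma_product (\<lambda>_. hilbert_cube) \<Gamma> (\<lambda>\<gamma>\<in>\<Gamma>. \<lambda>n. 0))
        = h ` topspace ?A"
    using V unfolding NY_Valdivia_def by blast
  let ?S = "subtopology (product_topology (\<lambda>_. hilbert_cube) \<Gamma>) (h ` topspace ?A)"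
  have hh: "homeomorphic_map ?A ?S h" using h by (simp add: embedding_map_def)
  have hc: "continuous_map ?A (product_topology (\<lambda>_. hilbert_cube) \<Gamma>) h"
    using homeomorphic_imp_continuous_map[OF hh] continuous_map_into_fulltopology by blast
  have hi: "inj_on h (topspace ?A)" and hs: "h ` topspace ?A = topspace ?S"
    using homeomorphic_imp_injective_map[OF hh] homeomorphic_imp_surjective_map[OF hh] by blast+
  have he: "h z \<in> extensional \<Gamma>" if "z \<in> topspace ?A" for z
  proof -
    have "h z \<in> topspace (product_topology (\<lambda>_. hilbert_cube) \<Gamma>)"
      using continuous_map_image_subset_topspace[OF hc] that by blast
    then show ?thesis by (simp add: PiE_iff)
  qed
  show ?thesis
  proof (rule NY_compact_if_finite_support_on_isolated[OF K])
    show "continuous_map ?A hilbert_cube (\<lambda>z. h z \<gamma>)" if "\<gamma> \<in> \<Gamma>" for \<gamma>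
      using hc that by (simp add: continuous_map_componentwise)
    show "\<exists>\<gamma>\<in>\<Gamma>. h (x, False) \<gamma> \<noteq> h (y, False) \<gamma>"
      if "x \<in> topspace K" "y \<in> topspace K" "x \<noteq> y" for x y
    proof (rule ccontr)
      assume "\<not> ?thesis"
      then have "h (x, False) = h (y, False)"
        using he that by (intro extensionalityI[of _ \<Gamma>]) auto
      then show False using hi that by (auto dest: inj_onD)
    qed
    show "finite {\<gamma> \<in> \<Gamma>. h (x, True) \<gamma> \<noteq> (\<lambda>n. 0)}" if x: "x \<in> topspace K" for x
    proof -
      have "openin ?S (h ` {(x, True)})"
        using homeomorphic_imp_open_map[OF hh] openin_AD_isolated[OF x] unfolding open_map_def by metis
      then have "openin ?S {h (x, True)}" by simp
      from isolated_point_in_dense_set[OF trans[OF dense hs] this]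
      have "h (x, True) \<in> sigma_product (\<lambda>_. hilbert_cube) \<Gamma> (\<lambda>\<gamma>\<in>\<Gamma>. \<lambda>n. 0)"
        by (rule IntD2)
      then have "finite {\<gamma> \<in> \<Gamma>. h (x, True) \<gamma> \<noteq> (\<lambda>\<gamma>\<in>\<Gamma>. \<lambda>n. 0) \<gamma>}"
        by (simp add: sigma_product_def)
      then show ?thesis by (rule rev_finite_subset) auto
    qed
  qed
qed

theorem theorem4p6:
  fixes K :: "'a topology"
  assumes "compact_space K" and "Hausdorff_space K"
  shows "(NY_compact K \<longleftrightarrow> NY_compact (alexandroff_duplicate K)) \<and>
         (NY_compact (alexandroff_duplicate K) \<longleftrightarrow> NY_Valdivia (alexandroff_duplicate K))"
proof -
  have "NY_Valdivia (alexandroff_duplicate K)" if "NY_compact (alexandroff_duplicate K)"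
    using NY_compact_imp_sigma_coordinates[OF that] NY_Valdivia_if_sigma_coordinates
      compact_space_AD[OF assms(1)] Hausdorff_space_AD[OF assms(2)] by metis
  then show ?thesis
    using NY_compact_AD[OF assms] NY_compact_if_NY_Valdivia_AD[OF assms] by blast
qed

end
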